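(* Suppose there is a constant $c_1$ such that $\|\ell'(\mathbf{x},y;\mathbf{w})\|\le c_1$ for all data samples $(\mathbf{x},y)$ and all $\mathbf{w}\in\mathbb{R}^P$ (for every client). Then the zCDP-NFL algorithm satisfies dynamic $\varphi_k^{(n)}$-zCDP, where the relation between the privacy value $\varphi_k^{(n)}>0$ and the noise variance $\sigma_k^2(n)$ is $$\sigma_k^2(n)=\frac{\Delta_{k,2}^2(n)}{2\varphi_k^{(n)}}\qquad\text{for every client } k\in\mathcal{C}\text{ and every iteration } n\ge 1.$$
   Context: Setting. $\mathcal{G}(\mathcal{C},\mathcal{E})$ is a connected undirected graph with vertex set (clients) $\mathcal{C}=\{1,\dots,K\}$; $\mathcal{N}_k$ is the set of neighbors of client $k$. Client $k$ holds a data set $\mathcal{D}_k=(\mathbf{X}_k,\mathbf{y}_k)$ of $M_k$ samples $(\mathbf{x}_{k,j},y_{k,j})\in\mathbb{R}^P\times\mathbb{R}$, $j=1,\dots,M_k$. For each sample $(\mathbf{x},y)$ the loss $\mathbf{w}\mapsto\ell(\mathbf{x},y;\mathbf{w})$ from $\mathbb{R}^P$ to $\mathbb{R}$ is convex, and the regularizer $R:\mathbb{R}^P\to\mathbb{R}$ is convex (neither needs to be smooth or strongly convex). $\ell'$ (with respect to $\mathbf{w}$) and $R'$ denote subgradients, selected by a fixed rule. Write $\ell(\mathbf{X}_k,\mathbf{y}_k;\mathbf{w})=\sum_{j=1}^{M_k}\ell(\mathbf{x}_{k,j},y_{k,j};\mathbf{w})$ and similarly for $\ell'$. Parameters: $\lambda>0$,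 penalty $\rho>0$, step sizes $\eta_k^{(n)}>0$. Algorithm zCDP-NFL. Initialize $\mathbf{w}_k^{(0)}=\mathbf{0}$, $\boldsymbol{\gamma}_k^{(0)}=\mathbf{0}$, and $\widetilde{\mathbf{w}}_k^{(0)}=\mathbf{w}_k^{(0)}+\boldsymbol{\xi}_k^{(0)}$. For $n=1,2,\dots$ every client $k$ computes $$\mathbf{w}_k^{(n)}=\arg\min_{\mathbf{w}}\ \hat f_k(\mathbf{w};\widetilde{\mathcal{V}}^{(n-1)})+\mathbf{w}^{\mathsf{T}}\boldsymbol{\gamma}_k^{(n-1)}+\rho\sum_{l\in\mathcal{N}_k}\left\|\mathbf{w}-\tfrac{\widetilde{\mathbf{w}}_k^{(n-1)}+\widetilde{\mathbf{w}}_l^{(n-1)}}{2}\right\|^2,$$ $$\widetilde{\mathbf{w}}_k^{(n)}=\mathbf{w}_k^{(n)}+\boldsymbol{\xi}_k^{(n)},\qquad \boldsymbol{\gamma}_k^{(n)}=\boldsymbol{\gamma}_k^{(n-1)}+\rho\sum_{l\in\mathcal{N}_k}\left(\widetilde{\mathbf{w}}_k^{(n)}-\widetilde{\mathbf{w}}_l^{(n)}\right),$$ where $\boldsymbol{\xi}_k^{(n)}\sim\mathcal{N}(\mathbf{0},\sigma_k^2(n)\mathbf{I}_P)$, independent over $k,n$, $\widetilde{\mathcal{V}}^{(n)}=\{\widetilde{\mathbf{w}}_k^{(n)}\}_{k\in\mathcal{C}}$, and $$\hat f_k(\mathbf{w};\widetilde{\mathcal{V}}^{(n-1)})=\frac{\ell(\mathbf{X}_k,\mathbf{y}_k;\widetilde{\mathbf{w}}_k^{(n-1)})}{M_k}+\frac{\lambda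 R(\widetilde{\mathbf{w}}_k^{(n-1)})}{K}+\frac{\|\mathbf{w}-\widetilde{\mathbf{w}}_k^{(n-1)}\|^2}{2\eta_k^{(n)}}+\left(\mathbf{w}-\widetilde{\mathbf{w}}_k^{(n-1)}\right)^{\mathsf{T}}\left(\frac{\ell'(\mathbf{X}_k,\mathbf{y}_k;\widetilde{\mathbf{w}}_k^{(n-1)})}{M_k}+\frac{\lambda R'(\widetilde{\mathbf{w}}_k^{(n-1)})}{K}\right).$$ The message shared by client $k$ with its neighbors at iteration $n$ is $\widetilde{\mathbf{w}}_k^{(n)}$. Sensitivity. $\mathcal{D}_k$ and $\mathcal{D}_k'$ are neighboring if they both have $M_k$ samples and differ only in one sample. $\mathbf{w}_{k,\mathcal{D}_k}^{(n)}$ and $\mathbf{w}_{k,\mathcal{D}_k'}^{(n)}$ are the primal updates $\mathbf{w}_k^{(n)}$ computed at iteration $n$ with $\mathcal{D}_k$ and $\mathcal{D}_k'$ respectively, from the same previously exchanged messages $\widetilde{\mathcal{V}}^{(n-1)}$ and the same $\boldsymbol{\gamma}_k^{(n-1)}$. The $l_2$-norm sensitivity is $\Delta_{k,2}(n)=\max_{\mathcal{D}_k,\mathcal{D}_k'}\|\mathbf{w}_{k,\mathcal{D}_k}^{(n)}-\mathbf{w}_{k,\mathcal{D}_k'}^{(n)}\|$ over neighboring data sets. Privacy notion. A randomized mechanism $\mathcal{M}$ is $\varphi$-zCDP if for all neighboring data sets $D,D'$ and all $\alpha\in(1,\infty)$, $D_\alpha(\mathcal{M}(D)\,\|\,\mathcal{M}(D'))\le\varphi\alpha$,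 where $D_\alpha$ is the R\'enyi divergence of order $\alpha$. The algorithm satisfies dynamic $\varphi_k^{(n)}$-zCDP if, for each client $k$ and each iteration $n$, the release of $\widetilde{\mathbf{w}}_k^{(n)}$ as a function of the local data set $\mathcal{D}_k$ (given the previously exchanged messages) is $\varphi_k^{(n)}$-zCDP. *)

theory Defs
  imports "HOL-Probability.Probability" "Graph_Theory.Graph_Theory"
begin

section \<open>Renyi divergence and zero-concentrated differential privacy\<close>

text \<open>
  For \<^term>\<open>\<alpha> > (1::real)\<close>: \<open>(1/(\<alpha>-1)) ln \<integral> (dP/dQ)^\<alpha> dQ\<close>, with value \<open>\<infinity>\<close> if \<open>P\<close> is not
  absolutely continuous with respect to \<open>Q\<close> or if the integral diverges.  For probability
  measures \<open>P\<close> absolutely continuous with respect to \<open>Q\<close>, the derivative is finite almost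
  everywhere and the integral is at least 1, so that neither \<^const>\<open>enn2real\<close> loses information.
\<close>

definition renyi_divergence :: "real \<Rightarrow> 'a measure \<Rightarrow> 'a measure \<Rightarrow> ereal" where
  "renyi_divergence \<alpha> P Q =
    (let I = (\<integral>\<^sup>+ x. ennreal (enn2real (RN_deriv Q P x) powr \<alpha>) \<partial>Q)
     in if absolutely_continuous Q P \<and> I \<noteq> \<infinity> then ereal (ln (enn2real I) / (\<alpha> - 1)) else \<infinity>)"

definition zCDP :: "('d \<Rightarrow> 'd \<Rightarrow> bool) \<Rightarrow> real \<Rightarrow> ('d \<Rightarrow> 'a measure) \<Rightarrow> bool" where
  "zCDP nbr \<phi> \<M> \<longleftrightarrow>
    (\<forall>D D' \<alpha>. nbr D D' \<longrightarrow> 1 < \<alpha> \<longrightarrow> renyi_divergence \<alpha> (\<M> D) (\<M> D') \<le> ereal (\<phi> * \<alpha>))"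

text \<open>
  The law \<open>N(0, v I)\<close>.  It is defined as the image of a standard normal vector so that the
  degenerate case \<^term>\<open>v = (0::real)\<close> is the Dirac measure at 0.
\<close>

definition isotropic_gaussian :: "real \<Rightarrow> (real^'p) measure" where
  "isotropic_gaussian v =
    distr (\<Pi>\<^sub>M i\<in>(UNIV :: 'p set). density lborel (\<lambda>x. ennreal (std_normal_density x))) borel
      (\<lambda>z. \<chi> i. sqrt v * z i)"

definition is_subgradient :: "('a::real_inner \<Rightarrow> real) \<Rightarrow> 'a \<Rightarrow> 'a \<Rightarrow> bool" where
  "is_subgradient f x g \<longleftrightarrow> (\<forall>y. f x + g \<bullet> (y - x) \<le> f y)"


section \<open>The algorithm\<close>

type_synonym 'p sample = "(real^'p) \<times> real"

text \<open>
  Clients are the numbers \<open>1, \<dots>, num_clients\<close>.  The field \<open>loss_sub\<close> (\<open>reg_sub\<close>) is the fixed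
  rule selecting a subgradient of the loss (regularizer) at each point; \<open>step_size k n\<close> is the
  step size of client \<open>k\<close> at iteration \<open>n\<close>.
\<close>

record 'p nfl =
  num_clients :: nat
  network :: "nat pair_pre_digraph"
  num_samples :: "nat \<Rightarrow> nat"
  loss :: "'p sample \<Rightarrow> real^'p \<Rightarrow> real"
  loss_sub :: "'p sample \<Rightarrow> real^'p \<Rightarrow> real^'p"
  reg :: "real^'p \<Rightarrow> real"
  reg_sub :: "real^'p \<Rightarrow> real^'p"
  reg_weight :: real
  penalty :: real
  step_size :: "nat \<Rightarrow> nat \<Rightarrow> real"

definition nbrs :: "'p::finite nfl \<Rightarrow> nat \<Rightarrow> nat set" where
  "nbrs A k = {l. (k, l) \<in> parcs (network A)}"

text \<open>
  In the following functions \<open>V\<close> is the profile of all messages of the previous iteration, \<open>g\<close> is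
  the previous dual variable of client \<open>k\<close>, and \<open>D\<close> is the local data set of client \<open>k\<close>.
\<close>

definition local_approx ::
  "'p::finite nfl \<Rightarrow> nat \<Rightarrow> nat \<Rightarrow> (nat \<Rightarrow> real^'p) \<Rightarrow> 'p sample list \<Rightarrow> real^'p \<Rightarrow> real" where
  "local_approx A k n V D w =
     (\<Sum>s\<leftarrow>D. loss A s (V k)) / real (num_samples A k)
     + reg_weight A * reg A (V k) / real (num_clients A)
     + (norm (w - V k))\<^sup>2 / (2 * step_size A k n)
     + (w - V k) \<bullet> ((\<Sum>s\<leftarrow>D. loss_sub A s (V k)) /\<^sub>R real (num_samples A k)
                    + (reg_weight A / real (num_clients A)) *\<^sub>R reg_sub A (V k))"

definition primal_update ::
  "'p::finite nfl \<Rightarrow> nat \<Rightarrow> nat \<Rightarrow> (nat \<Rightarrow> real^'p) \<Rightarrow> real^'p \<Rightarrow> 'p sample list \<Rightarrow> real^'p" where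
  "primal_update A k n V g D =
     arg_min (\<lambda>w. local_approx A k n V D w + w \<bullet> g
       + penalty A * (\<Sum>l\<in>nbrs A k. (norm (w - (V k + V l) /\<^sub>R 2))\<^sup>2)) (\<lambda>_. True)"

definition dual_update :: "'p::finite nfl \<Rightarrow> nat \<Rightarrow> real^'p \<Rightarrow> (nat \<Rightarrow> real^'p) \<Rightarrow> real^'p" where
  "dual_update A k g V = g + penalty A *\<^sub>R (\<Sum>l\<in>nbrs A k. V k - V l)"

text \<open>
  The run for local data sets \<open>D k\<close> and a noise realization \<open>z n k\<close>.  The state of a client
  consists of its primal variable, its dual variable, and its current (perturbed) message.
\<close>

primrec nfl_run ::
  "'p::finite nfl \<Rightarrow> (nat \<Rightarrow> 'p sample list) \<Rightarrow> (nat \<Rightarrow> nat \<Rightarrow> real^'p) \<Rightarrow>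
   nat \<Rightarrow> nat \<Rightarrow> (real^'p) \<times> (real^'p) \<times> (real^'p)" where
  "nfl_run A D z 0 = (\<lambda>k. (0, 0, 0 + z 0 k))"
| "nfl_run A D z (Suc n) =
    (let g = (\<lambda>k. fst (snd (nfl_run A D z n k)));
         V = (\<lambda>k. snd (snd (nfl_run A D z n k)));
         W = (\<lambda>k. primal_update A k (Suc n) V (g k) (D k));
         V' = (\<lambda>k. W k + z (Suc n) k)
     in (\<lambda>k. (W k, dual_update A k (g k) V', V' k)))"

definition messages ::
  "'p::finite nfl \<Rightarrow> (nat \<Rightarrow> 'p sample list) \<Rightarrow> (nat \<Rightarrow> nat \<Rightarrow> real^'p) \<Rightarrow> nat \<Rightarrow> nat \<Rightarrow> real^'p"
  where "messages A D z n k = snd (snd (nfl_run A D z n k))"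


section \<open>Conditioning on the exchanged messages\<close>

text \<open>
  A history \<open>h\<close> assigns to iteration \<open>m\<close> and client \<open>l\<close> the message \<open>h m l\<close> that was exchanged.
  It determines the dual variables, and \<open>primal_given A h n k D\<close> depends only on the messages of
  iterations before \<open>n\<close> and on the local data set \<open>D\<close>.
\<close>

primrec dual_given :: "'p::finite nfl \<Rightarrow> (nat \<Rightarrow> nat \<Rightarrow> real^'p) \<Rightarrow> nat \<Rightarrow> nat \<Rightarrow> real^'p" where
  "dual_given A h k 0 = 0"
| "dual_given A h k (Suc n) = dual_update A k (dual_given A h k n) (h (Suc n))"

definition primal_given ::
  "'p::finite nfl \<Rightarrow> (nat \<Rightarrow> nat \<Rightarrow> real^'p) \<Rightarrow> nat \<Rightarrow> nat \<Rightarrow> 'p sample list \<Rightarrow> real^'p" where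
  "primal_given A h n k D = primal_update A k n (h (n - 1)) (dual_given A h k (n - 1)) D"

lemma messages_eq_primal_given:
  "messages A D z (Suc n) k = primal_given A (messages A D z) (Suc n) k (D k) + z (Suc n) k"
proof -
  have dual: "fst (snd (nfl_run A D z m j)) = dual_given A (messages A D z) j m" for m j
    by (induction m arbitrary: j) (simp_all add: Let_def messages_def dual_update_def)
  have msg: "(\<lambda>j. snd (snd (nfl_run A D z m j))) = messages A D z m" for m
    by (simp add: messages_def fun_eq_iff)
  have "messages A D z (Suc n) k = snd (snd (nfl_run A D z (Suc n) k))"
    by (simp add: messages_def)
  then show ?thesis
    by (simp add: Let_def msg dual primal_given_def)
qed

definition neighboring :: "nat \<Rightarrow> 's list \<Rightarrow> 's list \<Rightarrow> bool" where
  "neighboring m D D' \<longleftrightarrow> length D = m \<and> length D' = m \<and> (\<exists>!j. j < m \<and> D ! j \<noteq> D' ! j)"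

text \<open>The maximum over all neighboring data sets need not be attained; it is read as a supremum.\<close>

definition sensitivity :: "'p::finite nfl \<Rightarrow> (nat \<Rightarrow> nat \<Rightarrow> real^'p) \<Rightarrow> nat \<Rightarrow> nat \<Rightarrow> real" where
  "sensitivity A h k n =
    Sup {norm (primal_given A h n k D - primal_given A h n k D') | D D'.
           neighboring (num_samples A k) D D'}"

text \<open>
  The law of the message of client \<open>k\<close> at iteration \<open>n\<close>, given the history \<open>h\<close> of the messages
  of the previous iterations; \<open>\<xi> n k\<close> is the noise.  As the noise is independent over clients and
  iterations, \<open>\<xi> n k\<close> is unaffected by conditioning on the past messages.
\<close>

definition release ::
  "'p::finite nfl \<Rightarrow> 'w measure \<Rightarrow> (nat \<Rightarrow> nat \<Rightarrow> 'w \<Rightarrow> real^'p) \<Rightarrow>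
   (nat \<Rightarrow> nat \<Rightarrow> real^'p) \<Rightarrow> nat \<Rightarrow> nat \<Rightarrow> 'p sample list \<Rightarrow> (real^'p) measure" where
  "release A \<Omega> \<xi> h k n D = distr \<Omega> borel (\<lambda>\<omega>. primal_given A h n k D + \<xi> n k \<omega>)"

text \<open>
  Here \<open>H\<close> is the set of message histories for which the guarantee is claimed: a singleton when
  the noise is calibrated to the sensitivity at the messages actually exchanged, \<^term>\<open>UNIV\<close> when
  it is calibrated to the worst case over all messages.
\<close>

definition dynamic_zCDP ::
  "'p::finite nfl \<Rightarrow> 'w measure \<Rightarrow> (nat \<Rightarrow> nat \<Rightarrow> 'w \<Rightarrow> real^'p) \<Rightarrow>
   (nat \<Rightarrow> nat \<Rightarrow> real^'p) set \<Rightarrow> (nat \<Rightarrow> nat \<Rightarrow> real) \<Rightarrow> bool" where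
  "dynamic_zCDP A \<Omega> \<xi> H \<phi> \<longleftrightarrow>
    (\<forall>k\<in>{1..num_clients A}. \<forall>n\<ge>1. \<forall>h\<in>H.
       zCDP (neighboring (num_samples A k)) (\<phi> k n) (release A \<Omega> \<xi> h k n))"

end

theory Submission
  imports Defs
begin

text \<open>
  Given the past messages, the release of client \<open>k\<close> is the deterministic vector
  \<open>\<mu> D = primal_given A h n k D\<close> plus isotropic Gaussian noise of variance \<open>\<sigma>\<^sup>2\<close>, so the theorem is
  the privacy guarantee of the Gaussian mechanism.  It has two ingredients.

  The first is the Renyi divergence of order \<open>\<alpha>\<close> between two translates of \<open>N(0, s\<^sup>2 I)\<close> that differ
  by \<open>d\<close>, which equals \<open>\<alpha> |d|\<^sup>2 / (2 s\<^sup>2)\<close> (lemma \<open>renyi_divergence_gaussian_shift\<close>).  By the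
  Cameron-Martin formula (lemma \<open>isotropic_gaussian_shift\<close>) the translate by \<open>d\<close> has the density
  \<open>L\<^sub>d x = exp (d \<bullet> x / s\<^sup>2 - |d|\<^sup>2 / (2 s\<^sup>2))\<close> with respect to the centred law.  The family \<open>L\<close> is
  closed under powers up to a constant: \<open>L\<^sub>d powr \<alpha>\<close> is \<open>exp ((\<alpha>\<^sup>2 - \<alpha>) |d|\<^sup>2 / (2 s\<^sup>2))\<close> times
  \<open>L\<close> at \<open>\<alpha> d\<close>.  As \<open>L\<close> at \<open>\<alpha> d\<close> is itself a probability density, the integral defining the
  divergence is this constant, and no Gaussian integral has to be computed.

  The second is that the supremum \<open>S\<close> of the sensitivities over the histories really dominates
  each \<open>|\<mu> D - \<mu> D'|\<close>.  A supremum of reals does so only if it is over a bounded set, and this is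
  where the bound on the subgradients enters: the update minimizes a quadratic with
  curvature depending neither on the data nor on the history, and the data enter only through its
  linear part (lemma \<open>primal_update_closed_form\<close>), so \<open>|\<mu> D - \<mu> D'|\<close> is bounded uniformly in
  \<open>h\<close>, \<open>D\<close> and \<open>D'\<close> (lemma \<open>norm_primal_given_diff_le\<close>).

  With \<open>\<sigma>\<^sup>2 = S\<^sup>2 / (2 \<phi>)\<close> the divergence is at most \<open>\<alpha> S\<^sup>2 / (2 \<sigma>\<^sup>2) = \<phi> \<alpha>\<close>.  If \<open>S = 0\<close>, the noise
  is degenerate, but then \<open>\<mu> D = \<mu> D'\<close> and the two releases have the same law.
\<close>


section \<open>Products of measures\<close>

lemma density_PiM:
  assumes fin: "finite I"
    and M: "product_sigma_finite M"
    and Mf: "product_sigma_finite (\<lambda>i. density (M i) (f i))"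
    and f: "\<And>i. i \<in> I \<Longrightarrow> f i \<in> borel_measurable (M i)"
  shows "density (PiM I M) (\<lambda>x. \<Prod>i\<in>I. f i (x i)) = PiM I (\<lambda>i. density (M i) (f i))"
proof (rule product_sigma_finite.PiM_eqI[OF Mf fin])
  have f': "(\<lambda>x. f i (x i)) \<in> borel_measurable (PiM I M)" if "i \<in> I" for i
    by (rule measurable_compose[OF measurable_component_singleton[OF that]]) (rule f[OF that])
  show "sets (density (PiM I M) (\<lambda>x. \<Prod>i\<in>I. f i (x i))) = sets (PiM I (\<lambda>i. density (M i) (f i)))"
    by (auto intro!: sets_PiM_cong)
  fix B assume "\<And>i. i \<in> I \<Longrightarrow> B i \<in> sets (density (M i) (f i))"
  then have B: "B i \<in> sets (M i)" if "i \<in> I" for i using that by simp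
  have box: "Pi\<^sub>E I B \<in> sets (PiM I M)"
    using B fin by (intro sets_PiM_I_finite) auto
  have "emeasure (density (PiM I M) (\<lambda>x. \<Prod>i\<in>I. f i (x i))) (Pi\<^sub>E I B)
      = (\<integral>\<^sup>+x. (\<Prod>i\<in>I. f i (x i)) * indicator (Pi\<^sub>E I B) x \<partial>PiM I M)"
    using f' box by (intro emeasure_density) (auto intro!: borel_measurable_prod_ennreal)
  also have "\<dots> = (\<integral>\<^sup>+x. (\<Prod>i\<in>I. f i (x i) * indicator (B i) (x i)) \<partial>PiM I M)"
  proof (rule nn_integral_cong)
    fix x assume "x \<in> space (PiM I M)"
    then have ext: "x \<in> extensional I" by (auto simp: space_PiM PiE_def)
    have "(\<Prod>i\<in>I. indicator (B i) (x i) :: ennreal) = indicator (Pi\<^sub>E I B) x"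
      using ext fin by (auto simp: indicator_def PiE_def Pi_iff prod_zero_iff)
    then show "(\<Prod>i\<in>I. f i (x i)) * indicator (Pi\<^sub>E I B) x
        = (\<Prod>i\<in>I. f i (x i) * indicator (B i) (x i))"
      by (simp add: prod.distrib)
  qed
  also have "\<dots> = (\<Prod>i\<in>I. \<integral>\<^sup>+y. f i y * indicator (B i) y \<partial>M i)"
    using f B by (intro product_sigma_finite.product_nn_integral_prod[OF M fin]) auto
  also have "\<dots> = (\<Prod>i\<in>I. emeasure (density (M i) (f i)) (B i))"
    using f B by (intro prod.cong) (auto simp: emeasure_density)
  finally show "emeasure (density (PiM I M) (\<lambda>x. \<Prod>i\<in>I. f i (x i))) (Pi\<^sub>E I B)
      = (\<Prod>i\<in>I. emeasure (density (M i) (f i)) (B i))" .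
qed

lemma distr_PiM_componentwise:
  assumes fin: "finite I"
    and M: "product_sigma_finite M"
    and Mg: "product_sigma_finite (\<lambda>i. distr (M i) (M' i) (g i))"
    and g: "\<And>i. i \<in> I \<Longrightarrow> g i \<in> measurable (M i) (M' i)"
  shows "distr (PiM I M) (PiM I M') (\<lambda>x. \<lambda>i\<in>I. g i (x i)) = PiM I (\<lambda>i. distr (M i) (M' i) (g i))"
proof (rule product_sigma_finite.PiM_eqI[OF Mg fin])
  have g': "(\<lambda>x. \<lambda>i\<in>I. g i (x i)) \<in> measurable (PiM I M) (PiM I M')"
    using g by (intro measurable_restrict) (rule measurable_compose[OF measurable_component_singleton])
  show "sets (distr (PiM I M) (PiM I M') (\<lambda>x. \<lambda>i\<in>I. g i (x i)))
      = sets (PiM I (\<lambda>i. distr (M i) (M' i) (g i)))"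
    by (auto intro!: sets_PiM_cong)
  fix B assume "\<And>i. i \<in> I \<Longrightarrow> B i \<in> sets (distr (M i) (M' i) (g i))"
  then have B: "B i \<in> sets (M' i)" if "i \<in> I" for i using that by simp
  have pre: "(\<lambda>x. \<lambda>i\<in>I. g i (x i)) -` Pi\<^sub>E I B \<inter> space (PiM I M)
      = Pi\<^sub>E I (\<lambda>i. g i -` B i \<inter> space (M i))"
    by (auto simp: space_PiM PiE_def Pi_iff)
  have "emeasure (distr (PiM I M) (PiM I M') (\<lambda>x. \<lambda>i\<in>I. g i (x i))) (Pi\<^sub>E I B)
      = emeasure (PiM I M) (Pi\<^sub>E I (\<lambda>i. g i -` B i \<inter> space (M i)))"
    using g' B fin by (subst emeasure_distr) (auto simp: pre intro!: sets_PiM_I_finite)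
  also have "\<dots> = (\<Prod>i\<in>I. emeasure (M i) (g i -` B i \<inter> space (M i)))"
    using g B by (intro product_sigma_finite.emeasure_PiM[OF M fin]) (auto intro: measurable_sets)
  also have "\<dots> = (\<Prod>i\<in>I. emeasure (distr (M i) (M' i) (g i)) (B i))"
    using g B by (intro prod.cong) (auto simp: emeasure_distr)
  finally show "emeasure (distr (PiM I M) (PiM I M') (\<lambda>x. \<lambda>i\<in>I. g i (x i))) (Pi\<^sub>E I B)
      = (\<Prod>i\<in>I. emeasure (distr (M i) (M' i) (g i)) (B i))" .
qed


section \<open>Translates of Gaussian measures\<close>

abbreviation std_normal :: "real measure" where
  "std_normal \<equiv> density lborel (\<lambda>x. ennreal (std_normal_density x))"

lemma std_normal_shift:
  "distr std_normal borel (\<lambda>x. x + v) = density std_normal (\<lambda>x. ennreal (exp (v * x - v\<^sup>2 / 2)))"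
proof -
  have "distr std_normal borel (\<lambda>x. x + v)
      = density (distr lborel borel ((+) v)) (\<lambda>x. ennreal (std_normal_density (x - v)))"
    by (subst density_distr) (auto simp: add.commute intro!: distr_cong)
  also have "\<dots> = density lborel (\<lambda>x. ennreal (std_normal_density (x - v)))"
    by (simp add: lborel_distr_plus)
  also have "\<dots> = density lborel (\<lambda>x. ennreal (std_normal_density x) * ennreal (exp (v * x - v\<^sup>2 / 2)))"
  proof (rule density_cong)
    have "std_normal_density (x - v) = std_normal_density x * exp (v * x - v\<^sup>2 / 2)" for x
      unfolding std_normal_density_def
      by (simp add: exp_add[symmetric] power2_eq_square field_simps)
    then show "AE x in lborel. ennreal (std_normal_density (x - v))
        = ennreal (std_normal_density x) * ennreal (exp (v * x - v\<^sup>2 / 2))"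
      by (simp add: ennreal_mult)
  qed auto
  also have "\<dots> = density std_normal (\<lambda>x. ennreal (exp (v * x - v\<^sup>2 / 2)))"
    by (subst density_density_eq) auto
  finally show ?thesis .
qed

lemma product_sigma_finite_prob:
  assumes "\<And>i. prob_space (M i)"
  shows "product_sigma_finite M"
  using assms by (auto simp: product_sigma_finite_def intro: prob_space_imp_sigma_finite)

lemma prob_space_std_normal: "prob_space std_normal"
  by (rule prob_space_normal_density) simp

lemma prob_space_PiM_std_normal: "prob_space (\<Pi>\<^sub>M i\<in>(UNIV :: 'p set). std_normal)"
  by (intro prob_space_PiM prob_space_std_normal)

lemma PiM_std_normal_shift:
  fixes v :: "'p::finite \<Rightarrow> real"
  defines "N \<equiv> (\<Pi>\<^sub>M i\<in>(UNIV :: 'p set). std_normal)"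
  shows "distr N N (\<lambda>z i. z i + v i)
    = density N (\<lambda>z. ennreal (exp (\<Sum>i\<in>UNIV. v i * z i - (v i)\<^sup>2 / 2)))"
proof -
  have N_borel: "sets N = sets (\<Pi>\<^sub>M i\<in>(UNIV :: 'p set). borel)"
    unfolding N_def by (intro sets_PiM_cong) auto
  have psf: "product_sigma_finite (\<lambda>i::'p. std_normal)"
    by (intro product_sigma_finite_prob prob_space_std_normal)
  have psf': "product_sigma_finite (\<lambda>i::'p. distr std_normal borel (\<lambda>x. x + v i))"
    by (intro product_sigma_finite_prob prob_space.prob_space_distr prob_space_std_normal) auto
  have "distr N N (\<lambda>z i. z i + v i)
      = distr N (\<Pi>\<^sub>M i\<in>(UNIV :: 'p set). borel) (\<lambda>z. \<lambda>i\<in>UNIV. z i + v i)"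
    using N_borel by (intro distr_cong) (auto simp: restrict_def)
  also have "\<dots> = (\<Pi>\<^sub>M i\<in>(UNIV :: 'p set). distr std_normal borel (\<lambda>x. x + v i))"
    unfolding N_def by (rule distr_PiM_componentwise[OF _ psf psf']) auto
  also have "\<dots> = (\<Pi>\<^sub>M i\<in>(UNIV :: 'p set). density std_normal (\<lambda>x. ennreal (exp (v i * x - (v i)\<^sup>2 / 2))))"
    by (simp add: std_normal_shift)
  also have "\<dots> = density N (\<lambda>z. \<Prod>i\<in>UNIV. ennreal (exp (v i * z i - (v i)\<^sup>2 / 2)))"
    unfolding N_def
    using psf' by (intro density_PiM[symmetric] psf) (auto simp: std_normal_shift)
  also have "\<dots> = density N (\<lambda>z. ennreal (exp (\<Sum>i\<in>UNIV. v i * z i - (v i)\<^sup>2 / 2)))"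
    by (simp add: prod_ennreal exp_sum)
  finally show ?thesis .
qed

lemma measurable_vec_scale [measurable]:
  "(\<lambda>z. \<chi> i. c * z i) \<in> measurable (\<Pi>\<^sub>M i\<in>(UNIV :: 'p::finite set). std_normal) (borel :: (real^'p) measure)"
  by (subst borel_measurable_iff_halfspace_le) (auto simp: Basis_vec_def inner_axis)

lemma prob_space_isotropic_gaussian: "prob_space (isotropic_gaussian v)"
  unfolding isotropic_gaussian_def
  by (intro prob_space.prob_space_distr prob_space_PiM_std_normal) measurable

lemma sets_isotropic_gaussian [simp, measurable_cong]: "sets (isotropic_gaussian v) = sets borel"
  by (simp add: isotropic_gaussian_def)

lemma space_isotropic_gaussian: "space (isotropic_gaussian v) = UNIV"
  by (simp add: isotropic_gaussian_def)

text \<open>The factor by which translation by \<open>d\<close> changes the law \<open>N(0, s\<^sup>2 I)\<close>.\<close>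

definition gaussian_likelihood :: "real \<Rightarrow> real^'p \<Rightarrow> real^'p \<Rightarrow> real" where
  "gaussian_likelihood s d x = exp (d \<bullet> x / s\<^sup>2 - (norm d)\<^sup>2 / (2 * s\<^sup>2))"

lemma gaussian_likelihood_measurable [measurable]:
  "gaussian_likelihood s d \<in> borel_measurable borel"
  unfolding gaussian_likelihood_def by measurable

lemma gaussian_likelihood_powr:
  "gaussian_likelihood s d x powr \<alpha>
    = exp (\<alpha> * (\<alpha> - 1) * (norm d)\<^sup>2 / (2 * s\<^sup>2)) * gaussian_likelihood s (\<alpha> *\<^sub>R d) x"
  unfolding gaussian_likelihood_def exp_add[symmetric] exp_powr_real
  by (simp add: power_mult_distrib power2_eq_square diff_divide_distrib algebra_simps)

text \<open>
  The Cameron-Martin formula.  It is inherited from the standard normal coordinates: a translation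
  by \<open>d\<close> after scaling by \<open>s\<close> is a translation by \<open>d / s\<close> before scaling.
\<close>

lemma isotropic_gaussian_shift:
  fixes d :: "real^'p::finite"
  assumes "s > 0"
  shows "distr (isotropic_gaussian (s\<^sup>2)) borel (\<lambda>x. x + d)
    = density (isotropic_gaussian (s\<^sup>2)) (\<lambda>x. ennreal (gaussian_likelihood s d x))"
proof -
  define N where "N = (\<Pi>\<^sub>M i\<in>(UNIV :: 'p set). std_normal)"
  define T :: "('p \<Rightarrow> real) \<Rightarrow> real^'p" where "T = (\<lambda>z. \<chi> i. s * z i)"
  have T [measurable]: "T \<in> measurable N borel"
    unfolding T_def N_def by measurable
  have shift: "(\<lambda>z i. z i + d $ i / s) \<in> measurable N N"
    unfolding N_def by (intro measurable_PiM_single') (auto simp: space_PiM)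
  have G: "isotropic_gaussian (s\<^sup>2) = distr N borel T"
    using assms by (simp add: isotropic_gaussian_def N_def T_def)
  have "distr (distr N borel T) borel (\<lambda>x. x + d) = distr N borel (\<lambda>z. T z + d)"
    by (subst distr_distr) (auto simp: comp_def)
  also have "\<dots> = distr N borel (T \<circ> (\<lambda>z i. z i + d $ i / s))"
    using assms by (intro distr_cong) (auto simp: T_def vec_eq_iff field_simps)
  also have "\<dots> = distr (distr N N (\<lambda>z i. z i + d $ i / s)) borel T"
    by (rule distr_distr[symmetric, OF T shift])
  also have "\<dots> = distr (density N (\<lambda>z. ennreal (exp (\<Sum>i\<in>UNIV. d $ i / s * z i - (d $ i / s)\<^sup>2 / 2)))) borel T"
    unfolding N_def by (subst PiM_std_normal_shift) simp
  also have "\<dots> = distr (density N (\<lambda>z. ennreal (gaussian_likelihood s d (T z)))) borel T"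
  proof -
    have "(\<Sum>i\<in>UNIV. d $ i / s * z i - (d $ i / s)\<^sup>2 / 2)
        = d \<bullet> T z / s\<^sup>2 - (norm d)\<^sup>2 / (2 * s\<^sup>2)" for z
      using assms unfolding power2_norm_eq_inner
      by (simp add: inner_vec_def T_def sum_subtractf sum_divide_distrib power2_eq_square mult.assoc
          mult.commute[of _ 2])
    then show ?thesis by (simp add: gaussian_likelihood_def)
  qed
  also have "\<dots> = density (distr N borel T) (\<lambda>x. ennreal (gaussian_likelihood s d x))"
    by (subst density_distr) auto
  finally show ?thesis by (simp add: G)
qed

lemma nn_integral_gaussian_likelihood:
  assumes "s > 0"
  shows "(\<integral>\<^sup>+x. ennreal (gaussian_likelihood s d x) \<partial>isotropic_gaussian (s\<^sup>2)) = 1"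
proof -
  interpret P: prob_space "distr (isotropic_gaussian (s\<^sup>2)) borel (\<lambda>x. x + d)"
    by (intro prob_space.prob_space_distr prob_space_isotropic_gaussian) measurable
  have "emeasure (density (isotropic_gaussian (s\<^sup>2)) (\<lambda>x. ennreal (gaussian_likelihood s d x))) UNIV = 1"
    using P.emeasure_space_1 unfolding isotropic_gaussian_shift[OF assms, of d]
    by (simp add: space_isotropic_gaussian)
  then show ?thesis by (subst (asm) emeasure_density) auto
qed


section \<open>Renyi divergence of Gaussian translates\<close>

lemma renyi_divergence_density:
  assumes Q: "prob_space Q"
    and f: "f \<in> borel_measurable Q" "\<And>x. f x \<ge> 0"
    and P: "P = density Q (\<lambda>x. ennreal (f x))"
    and I: "(\<integral>\<^sup>+x. ennreal (f x powr \<alpha>) \<partial>Q) = ennreal c" "c \<ge> 0"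
  shows "renyi_divergence \<alpha> P Q = ereal (ln c / (\<alpha> - 1))"
proof -
  interpret Q: prob_space Q by fact
  have "AE x in Q. ennreal (f x) = RN_deriv Q P x"
    using f P by (intro Q.RN_deriv_unique) auto
  then have "(\<integral>\<^sup>+x. ennreal (enn2real (RN_deriv Q P x) powr \<alpha>) \<partial>Q) = (\<integral>\<^sup>+x. ennreal (f x powr \<alpha>) \<partial>Q)"
    by (intro nn_integral_cong_AE) (auto elim!: eventually_mono simp: f(2) dest: sym)
  moreover have "absolutely_continuous Q P"
    unfolding P using f(1) by (intro absolutely_continuousI_density) auto
  ultimately show ?thesis
    using I by (simp add: renyi_divergence_def)
qed

lemma renyi_divergence_self:
  assumes "prob_space P"
  shows "renyi_divergence \<alpha> P P = 0"
proof -
  interpret prob_space P by fact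
  have "renyi_divergence \<alpha> P P = ereal (ln 1 / (\<alpha> - 1))"
    by (rule renyi_divergence_density[OF assms, where f = "\<lambda>_. 1"])
      (simp_all add: emeasure_space_1 density_1)
  then show ?thesis by (simp add: zero_ereal_def)
qed

text \<open>Translating both laws by \<open>- y\<close> reduces to the case in which the second law is centred.\<close>

lemma renyi_divergence_gaussian_shift:
  fixes x y :: "real^'p::finite"
  assumes s: "s > 0" and \<alpha>: "\<alpha> > 1"
  shows "renyi_divergence \<alpha> (distr (isotropic_gaussian (s\<^sup>2)) borel (\<lambda>z. x + z))
      (distr (isotropic_gaussian (s\<^sup>2)) borel (\<lambda>z. y + z))
    = ereal (\<alpha> * (norm (x - y))\<^sup>2 / (2 * s\<^sup>2))"
proof -
  define G where "G = (isotropic_gaussian (s\<^sup>2) :: (real^'p) measure)"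
  define L where "L = gaussian_likelihood s (x - y)"
  define C where "C = exp (\<alpha> * (\<alpha> - 1) * (norm (x - y))\<^sup>2 / (2 * s\<^sup>2))"
  have sets_G [measurable_cong, simp]: "sets G = sets borel" by (simp add: G_def)
  have L [measurable]: "L \<in> borel_measurable borel" by (simp add: L_def)
  have "distr G borel (\<lambda>z. x + z) = distr (distr G borel (\<lambda>z. z + (x - y))) borel (\<lambda>z. y + z)"
    by (subst distr_distr) (auto simp: comp_def add.commute[of y] intro!: distr_cong)
  also have "\<dots> = distr (density G (\<lambda>z. ennreal (L ((y + z) - y)))) borel (\<lambda>z. y + z)"
    using isotropic_gaussian_shift[OF s, of "x - y"] by (simp add: G_def L_def)
  also have "\<dots> = density (distr G borel (\<lambda>z. y + z)) (\<lambda>w. ennreal (L (w - y)))"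
    by (rule density_distr[symmetric]) measurable
  finally have P: "distr G borel (\<lambda>z. x + z)
      = density (distr G borel (\<lambda>z. y + z)) (\<lambda>w. ennreal (L (w - y)))" .
  have "(\<integral>\<^sup>+w. ennreal (L (w - y) powr \<alpha>) \<partial>distr G borel (\<lambda>z. y + z)) = (\<integral>\<^sup>+z. ennreal (L z powr \<alpha>) \<partial>G)"
    by (subst nn_integral_distr) auto
  also have "\<dots> = (\<integral>\<^sup>+z. ennreal C * ennreal (gaussian_likelihood s (\<alpha> *\<^sub>R (x - y)) z) \<partial>G)"
    unfolding L_def C_def gaussian_likelihood_powr
    by (simp add: ennreal_mult gaussian_likelihood_def)
  also have "\<dots> = ennreal C"
    by (subst nn_integral_cmult) (auto simp: G_def nn_integral_gaussian_likelihood[OF s])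
  finally have I: "(\<integral>\<^sup>+w. ennreal (L (w - y) powr \<alpha>) \<partial>distr G borel (\<lambda>z. y + z)) = ennreal C" .
  have "renyi_divergence \<alpha> (distr G borel (\<lambda>z. x + z)) (distr G borel (\<lambda>z. y + z))
      = ereal (ln C / (\<alpha> - 1))"
    unfolding P
  proof (rule renyi_divergence_density[OF _ _ _ refl I])
    show "prob_space (distr G borel (\<lambda>z. y + z))"
      unfolding G_def by (intro prob_space.prob_space_distr prob_space_isotropic_gaussian) measurable
  qed (auto simp: L_def gaussian_likelihood_def C_def)
  also have "ln C / (\<alpha> - 1) = \<alpha> * (norm (x - y))\<^sup>2 / (2 * s\<^sup>2)"
    using \<alpha> by (simp add: C_def)
  finally show ?thesis by (simp add: G_def)
qed


section \<open>The sensitivity of the primal update\<close>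

lemma arg_min_quadratic:
  fixes b :: "'a::real_inner"
  assumes a: "a > 0"
  shows "arg_min (\<lambda>w. a * (norm w)\<^sup>2 + w \<bullet> b + c) (\<lambda>_. True) = - (1 / (2 * a)) *\<^sub>R b"
proof -
  define m where "m = - (1 / (2 * a)) *\<^sub>R b"
  have b: "b = - (2 * a) *\<^sub>R m" using a by (simp add: m_def)
  have square: "a * (norm w)\<^sup>2 + w \<bullet> b + c = a * (norm (w - m))\<^sup>2 - a * (norm m)\<^sup>2 + c" for w
    unfolding b power2_norm_eq_inner
    by (simp add: inner_diff_left inner_diff_right inner_commute algebra_simps)
  have "arg_min (\<lambda>w. a * (norm w)\<^sup>2 + w \<bullet> b + c) (\<lambda>_. True) = m"
    unfolding square
  proof (rule arg_minI[where x = m])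
    fix x assume "\<forall>y. True \<longrightarrow> \<not> a * (norm (y - m))\<^sup>2 - a * (norm m)\<^sup>2 + c
        < a * (norm (x - m))\<^sup>2 - a * (norm m)\<^sup>2 + c"
    from this[rule_format, of m] a show "x = m" by (auto simp: zero_less_mult_iff)
  qed (use a in \<open>auto simp: not_less\<close>)
  then show ?thesis by (simp add: m_def)
qed

text \<open>The coefficient of \<open>|w|\<^sup>2\<close> in the objective of the primal update, i.e. half its second derivative.\<close>

definition curvature :: "'p::finite nfl \<Rightarrow> nat \<Rightarrow> nat \<Rightarrow> real" where
  "curvature A k n = 1 / (2 * step_size A k n) + penalty A * real (card (nbrs A k))"

lemma curvature_pos: "step_size A k n > 0 \<Longrightarrow> penalty A > 0 \<Longrightarrow> curvature A k n > 0"
  unfolding curvature_def by (intro add_pos_nonneg) auto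

text \<open>
  The proximal term and the consensus penalty are isotropic quadratics and the loss enters linearized,
  so the objective is an isotropic quadratic, minimized by completing the square.  The data set
  occurs in the minimizer only in the sum of subgradients.
\<close>

lemma primal_update_closed_form:
  assumes "step_size A k n > 0" and "penalty A > 0"
  shows "primal_update A k n V g D = - (1 / (2 * curvature A k n)) *\<^sub>R
    ((\<Sum>s\<leftarrow>D. loss_sub A s (V k)) /\<^sub>R real (num_samples A k)
     + (reg_weight A / real (num_clients A)) *\<^sub>R reg_sub A (V k)
     + g - (1 / step_size A k n) *\<^sub>R V k
     - (2 * penalty A) *\<^sub>R (\<Sum>l\<in>nbrs A k. (V k + V l) /\<^sub>R 2))"
    (is "_ = _ *\<^sub>R ?b")
proof -
  define \<eta> where "\<eta> = step_size A k n"
  define G where "G = (\<Sum>s\<leftarrow>D. loss_sub A s (V k)) /\<^sub>R real (num_samples A k)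
     + (reg_weight A / real (num_clients A)) *\<^sub>R reg_sub A (V k)"
  define m where "m l = (V k + V l) /\<^sub>R 2" for l
  define u where "u = (\<Sum>s\<leftarrow>D. loss A s (V k)) / real (num_samples A k)
     + reg_weight A * reg A (V k) / real (num_clients A)"
  define c where "c = u + (norm (V k))\<^sup>2 / (2 * \<eta>) - V k \<bullet> G
     + penalty A * (\<Sum>l\<in>nbrs A k. (norm (m l))\<^sup>2)"
  have prox: "(norm (w - v))\<^sup>2 = (norm w)\<^sup>2 - 2 * (w \<bullet> v) + (norm v)\<^sup>2" for w v :: "real^'a"
    unfolding power2_norm_eq_inner by (simp add: inner_diff_left inner_diff_right inner_commute)
  have cons: "(\<Sum>l\<in>nbrs A k. (norm (w - m l))\<^sup>2)
      = real (card (nbrs A k)) * (norm w)\<^sup>2 - 2 * (w \<bullet> (\<Sum>l\<in>nbrs A k. m l))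
        + (\<Sum>l\<in>nbrs A k. (norm (m l))\<^sup>2)" for w
    by (simp add: prox sum.distrib sum_subtractf inner_sum_right sum_distrib_left)
  have b: "?b = G + g - (1 / \<eta>) *\<^sub>R V k - (2 * penalty A) *\<^sub>R (\<Sum>l\<in>nbrs A k. m l)"
    by (simp add: G_def m_def \<eta>_def)
  have "local_approx A k n V D w + w \<bullet> g
      + penalty A * (\<Sum>l\<in>nbrs A k. (norm (w - (V k + V l) /\<^sub>R 2))\<^sup>2)
      = curvature A k n * (norm w)\<^sup>2 + w \<bullet> ?b + c" for w
  proof -
    have "local_approx A k n V D w = u + (norm (w - V k))\<^sup>2 / (2 * \<eta>) + (w - V k) \<bullet> G"
      by (simp add: local_approx_def u_def G_def \<eta>_def)
    then show ?thesis
      unfolding b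
      unfolding m_def[symmetric]
      unfolding cons c_def curvature_def \<eta>_def[symmetric]
      unfolding prox
      by (simp add: inner_diff_left inner_diff_right inner_add_right diff_divide_distrib
          add_divide_distrib algebra_simps)
  qed
  then show ?thesis
    unfolding primal_update_def by (simp add: arg_min_quadratic[OF curvature_pos[OF assms]])
qed

lemma norm_sum_list_le:
  fixes f :: "'s \<Rightarrow> 'a::real_normed_vector"
  assumes "\<And>s. norm (f s) \<le> c"
  shows "norm (\<Sum>s\<leftarrow>D. f s) \<le> real (length D) * c"
proof (induction D)
  case (Cons s D)
  have "norm (f s + (\<Sum>s\<leftarrow>D. f s)) \<le> norm (f s) + norm (\<Sum>s\<leftarrow>D. f s)"
    by (rule norm_triangle_ineq)
  also have "\<dots> \<le> c + real (length D) * c"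
    by (intro add_mono assms Cons.IH)
  finally show ?case by (simp add: algebra_simps)
qed simp

text \<open>
  Replacing a single sample changes the sum of subgradients by at most \<open>2 c\<close>; the cruder bound
  used here replaces all samples.  Only its uniformity in the history matters.
\<close>

lemma norm_primal_given_diff_le:
  assumes pos: "step_size A k n > 0" "penalty A > 0" "num_samples A k \<ge> 1"
    and bounded: "\<And>s w. norm (loss_sub A s w) \<le> c"
    and len: "length D = num_samples A k" "length D' = num_samples A k"
  shows "norm (primal_given A h n k D - primal_given A h n k D') \<le> c / curvature A k n"
proof -
  define M where "M = real (num_samples A k)"
  define a where "a = curvature A k n"
  define S where "S E = (\<Sum>s\<leftarrow>E. loss_sub A s (h (n - 1) k))" for E
  have a: "a > 0" unfolding a_def by (rule curvature_pos[OF pos(1,2)])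
  have M: "M > 0" using pos(3) by (simp add: M_def)
  have "norm (S E) \<le> M * c" if "length E = num_samples A k" for E
    using norm_sum_list_le[of "\<lambda>s. loss_sub A s (h (n - 1) k)" c E, OF bounded] that
    by (simp add: S_def M_def)
  then have "norm (S D) \<le> M * c" "norm (S D') \<le> M * c"
    using len by auto
  then have S: "norm (S D' - S D) \<le> 2 * M * c"
    using norm_triangle_ineq4[of "S D'" "S D"] by linarith
  obtain r where r: "primal_given A h n k E = - (1 / (2 * a)) *\<^sub>R (S E /\<^sub>R M + r)" for E
  proof
    fix E
    show "primal_given A h n k E = - (1 / (2 * a)) *\<^sub>R (S E /\<^sub>R M +
      ((reg_weight A / real (num_clients A)) *\<^sub>R reg_sub A (h (n - 1) k)
       + dual_given A h k (n - 1) - (1 / step_size A k n) *\<^sub>R h (n - 1) k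
       - (2 * penalty A) *\<^sub>R (\<Sum>l\<in>nbrs A k. (h (n - 1) k + h (n - 1) l) /\<^sub>R 2)))"
      unfolding primal_given_def primal_update_closed_form[OF pos(1,2)] a_def M_def S_def
      by (simp only: add.assoc add_diff_eq)
  qed
  have "norm (primal_given A h n k D - primal_given A h n k D')
      = norm ((1 / (2 * a)) *\<^sub>R ((S D' - S D) /\<^sub>R M))"
    unfolding r by (simp add: scaleR_diff_right scaleR_add_right)
  also have "\<dots> = 1 / (2 * a) * (inverse M * norm (S D' - S D))"
    unfolding norm_scaleR using a M by simp
  also have "\<dots> \<le> 1 / (2 * a) * (inverse M * (2 * M * c))"
    using S a M by (intro mult_left_mono) auto
  also have "\<dots> = c / a" using a M by (simp add: field_simps)
  finally show ?thesis by (simp add: a_def)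
qed

text \<open>This makes the sensitivity a supremum over a nonempty set.\<close>

lemma neighboring_exists:
  assumes "m \<ge> 1"
  shows "\<exists>D D' :: 'p::finite sample list. neighboring m D D'"
proof (intro exI)
  show "neighboring m (replicate m (0, 0)) ((replicate m (0, 0))[0 := (0 :: real^'p, 1 :: real)])"
    unfolding neighboring_def
    using assms by (auto simp: nth_list_update intro!: ex1I[of _ 0] split: if_splits)
qed

lemma primal_given_diff_le_SUP_sensitivity:
  assumes pos: "step_size A k n > 0" "penalty A > 0" "num_samples A k \<ge> 1"
    and bounded: "\<And>s w. norm (loss_sub A s w) \<le> c"
    and "h \<in> H" and nb: "neighboring (num_samples A k) D D'"
  shows "norm (primal_given A h n k D - primal_given A h n k D') \<le> (SUP h\<in>H. sensitivity A h k n)"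
proof -
  define X where "X h = {norm (primal_given A h n k D - primal_given A h n k D') | D D'.
      neighboring (num_samples A k) D D'}" for h
  have sens: "sensitivity A h k n = Sup (X h)" for h
    by (simp add: sensitivity_def X_def)
  have le: "x \<le> c / curvature A k n" if "x \<in> X h" for x h
    using that norm_primal_given_diff_le[OF pos bounded]
    by (auto simp: X_def neighboring_def)
  have ne: "X h \<noteq> {}" for h
    using neighboring_exists[OF pos(3), where ?'p = 'a] by (auto simp: X_def)
  have "norm (primal_given A h n k D - primal_given A h n k D') \<le> Sup (X h)"
  proof (rule cSup_upper)
    show "norm (primal_given A h n k D - primal_given A h n k D') \<in> X h"
      using nb by (auto simp: X_def)
    show "bdd_above (X h)"
      using le by (intro bdd_aboveI)
  qed
  also have "\<dots> \<le> (SUP h\<in>H. Sup (X h))"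
  proof (rule cSUP_upper[OF \<open>h \<in> H\<close>])
    show "bdd_above ((\<lambda>h. Sup (X h)) ` H)"
      using le ne by (intro bdd_aboveI2[of _ _ "c / curvature A k n"] cSup_least)
  qed
  finally show ?thesis by (simp add: sens)
qed


section \<open>The privacy guarantee\<close>

text \<open>
  The divergence between two Gaussian translates is linear in \<open>\<alpha>\<close>, so one variance serves all orders.
  The degenerate case \<open>S = 0\<close> causes no difficulty, since \<open>\<mu>\<close> then agrees on neighbours.
\<close>

lemma zCDP_gaussian_mechanism:
  fixes \<mu> :: "'d \<Rightarrow> real^'p::finite"
  assumes sens: "\<And>D D'. nbr D D' \<Longrightarrow> norm (\<mu> D - \<mu> D') \<le> S"
    and \<phi>: "\<phi> > 0"
    and var: "\<sigma>\<^sup>2 = S\<^sup>2 / (2 * \<phi>)"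
  shows "zCDP nbr \<phi> (\<lambda>D. distr (isotropic_gaussian (\<sigma>\<^sup>2)) borel (\<lambda>z. \<mu> D + z))"
  unfolding zCDP_def
proof (intro allI impI)
  fix D D' and \<alpha> :: real
  assume nb: "nbr D D'" and \<alpha>: "1 < \<alpha>"
  let ?R = "\<lambda>D. distr (isotropic_gaussian (\<sigma>\<^sup>2)) borel (\<lambda>z. \<mu> D + z)"
  show "renyi_divergence \<alpha> (?R D) (?R D') \<le> ereal (\<phi> * \<alpha>)"
  proof (cases "\<mu> D = \<mu> D'")
    case True
    have "prob_space (?R D')"
      by (intro prob_space.prob_space_distr prob_space_isotropic_gaussian) measurable
    then show ?thesis
      using True \<phi> \<alpha> by (simp add: renyi_divergence_self)
  next
    case False
    have d: "0 < norm (\<mu> D - \<mu> D')" "norm (\<mu> D - \<mu> D') \<le> S"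
      using False sens[OF nb] by auto
    then have S: "S > 0" by linarith
    then have "\<sigma>\<^sup>2 > 0" using var \<phi> by simp
    then have "\<bar>\<sigma>\<bar> > 0" by simp
    \<comment> \<open>The shift formula is stated for a positive scale; the law depends on \<open>\<sigma>\<close> only through \<open>\<sigma>\<^sup>2\<close>, so its sign is immaterial.\<close>
    then have "renyi_divergence \<alpha> (?R D) (?R D') = ereal (\<alpha> * (norm (\<mu> D - \<mu> D'))\<^sup>2 / (2 * \<sigma>\<^sup>2))"
      using renyi_divergence_gaussian_shift[of "\<bar>\<sigma>\<bar>" \<alpha> "\<mu> D" "\<mu> D'"] \<alpha> by simp
    also have "\<alpha> * (norm (\<mu> D - \<mu> D'))\<^sup>2 / (2 * \<sigma>\<^sup>2) \<le> \<alpha> * S\<^sup>2 / (2 * \<sigma>\<^sup>2)"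
      using d \<alpha> by (intro divide_right_mono mult_left_mono power_mono) auto
    also have "\<alpha> * S\<^sup>2 / (2 * \<sigma>\<^sup>2) = \<phi> * \<alpha>"
      using S \<phi> by (simp add: var)
    finally show ?thesis by simp
  qed
qed

lemma release_eq_gaussian:
  assumes "\<xi> n k \<in> borel_measurable \<Omega>"
    and "distr \<Omega> borel (\<xi> n k) = isotropic_gaussian v"
  shows "release A \<Omega> \<xi> h k n D
    = distr (isotropic_gaussian v) borel (\<lambda>z. primal_given A h n k D + z)"
  unfolding release_def assms(2)[symmetric]
  using assms(1) by (subst distr_distr) (auto simp: comp_def)

theorem theoremI:
  fixes A :: "'p::finite nfl"
    and \<Omega> :: "'w measure"
    and \<xi> :: "nat \<Rightarrow> nat \<Rightarrow> 'w \<Rightarrow> real^'p"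
    and \<sigma> \<phi> :: "nat \<Rightarrow> nat \<Rightarrow> real"
    and c\<^sub>1 :: real
    and H :: "(nat \<Rightarrow> nat \<Rightarrow> real^'p) set"
  assumes network: "pair_graph (network A)" "pverts (network A) = {1..num_clients A}"
      "Digraph_Component.connected (with_proj (network A))"
    and num_samples: "\<And>k. k \<in> {1..num_clients A} \<Longrightarrow> num_samples A k \<ge> 1"
    and loss_convex: "\<And>s. convex_on UNIV (loss A s)"
    and loss_sub: "\<And>s w. is_subgradient (loss A s) w (loss_sub A s w)"
    and reg_convex: "convex_on UNIV (reg A)"
    and reg_sub: "\<And>w. is_subgradient (reg A) w (reg_sub A w)"
    and reg_weight: "reg_weight A > 0"
    and penalty: "penalty A > 0"
    and step_size: "\<And>k n. k \<in> {1..num_clients A} \<Longrightarrow> n \<ge> 1 \<Longrightarrow> step_size A k n > 0"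
    and prob: "prob_space \<Omega>"
    and noise_indep: "prob_space.indep_vars \<Omega> (\<lambda>_. borel) (\<lambda>(n, k). \<xi> n k)
      (UNIV \<times> {1..num_clients A})"
    and noise_law: "\<And>k n. k \<in> {1..num_clients A} \<Longrightarrow>
      distr \<Omega> borel (\<xi> n k) = isotropic_gaussian ((\<sigma> k n)\<^sup>2)"
    and bounded: "\<And>s w. norm (loss_sub A s w) \<le> c\<^sub>1"
    and privacy_pos: "\<And>k n. k \<in> {1..num_clients A} \<Longrightarrow> n \<ge> 1 \<Longrightarrow> \<phi> k n > 0"
    and variance: "\<And>k n. k \<in> {1..num_clients A} \<Longrightarrow> n \<ge> 1 \<Longrightarrow>
      (\<sigma> k n)\<^sup>2 = (SUP h\<in>H. sensitivity A h k n)\<^sup>2 / (2 * \<phi> k n)"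
  shows "dynamic_zCDP A \<Omega> \<xi> H \<phi>"
  unfolding dynamic_zCDP_def
proof (intro ballI allI impI)
  fix k n :: nat and h
  assume k: "k \<in> {1..num_clients A}" and n: "1 \<le> n" and h: "h \<in> H"
  have "\<xi> n k \<in> borel_measurable \<Omega>"
    using noise_indep k unfolding prob_space.indep_vars_def[OF prob] by auto
  then have "release A \<Omega> \<xi> h k n
      = (\<lambda>D. distr (isotropic_gaussian ((\<sigma> k n)\<^sup>2)) borel (\<lambda>z. primal_given A h n k D + z))"
    by (intro ext release_eq_gaussian noise_law k)
  moreover have "zCDP (neighboring (num_samples A k)) (\<phi> k n)
      (\<lambda>D. distr (isotropic_gaussian ((\<sigma> k n)\<^sup>2)) borel (\<lambda>z. primal_given A h n k D + z))"
    using primal_given_diff_le_SUP_sensitivity[OF step_size[OF k n] penalty num_samples[OF k] bounded h]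
      privacy_pos[OF k n] variance[OF k n]
    by (rule zCDP_gaussian_mechanism)
  ultimately show "zCDP (neighboring (num_samples A k)) (\<phi> k n) (release A \<Omega> \<xi> h k n)"
    by simp
qed

end
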